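(* Let $A=\begin{pmatrix}2&-b\\-c&2\end{pmatrix}$ with $b,c$ positive integers (i.e. $A$ is any $2\times2$ indecomposable symmetrisable generalised Cartan matrix). There are finitely many arithmetic $\mathbf{Y}$-frieze patterns associated to $A$ if and only if $A$ is of finite type (i.e. $bc\le3$). Moreover, the number of arithmetic $\mathbf{Y}$-frieze patterns associated to $A$ is $5$ if $A$ is of type $A_2$ ($bc=1$), $10$ if $A$ is of type $C_2$ ($bc=2$), and $21$ if $A$ is of type $G_2$ ($bc=3$).
   Context: An arithmetic $\mathbf{Y}$-frieze pattern associated to $A=(a_{i,j})$ is a map $k:[1,2]\times\mathbb{Z}\to\mathbb{Z}_{>0}$ with $k(i,m)k(i,m+1)=\prod_{j>i}(1+k(j,m))^{-a_{j,i}}\prod_{j<i}(1+k(j,m+1))^{-a_{j,i}}$ for all $(i,m)$; for this $A$ this reads $k(1,m)k(1,m+1)=(1+k(2,m))^{c}$ and $k(2,m)k(2,m+1)=(1+k(1,m+1))^{b}$. *)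

theory Defs
  imports Complex_Main "HOL-Library.FuncSet"
begin

text \<open>An \<open>r \<times> r\<close> integer matrix is a function \<open>A :: nat \<Rightarrow> nat \<Rightarrow> int\<close> of which only the
  entries \<open>A i j\<close> with \<open>i, j \<in> {1..r}\<close> matter.\<close>

definition cartan2 :: "nat \<Rightarrow> nat \<Rightarrow> nat \<Rightarrow> nat \<Rightarrow> int" where
  "cartan2 b c i j = (if i = j then 2 else if i = 1 then - int b else - int c)"

text \<open>Patterns are extensional functions, hence determined by their values on \<open>{1..r} \<times> \<int>\<close>, so
  that counting them is meaningful. Off-diagonal entries of a generalised Cartan matrix are
  nonpositive, so the truncation in \<open>nat (- A j i)\<close> has no effect.\<close>

definition Y_frieze_patterns :: "nat \<Rightarrow> (nat \<Rightarrow> nat \<Rightarrow> int) \<Rightarrow> (nat \<times> int \<Rightarrow> nat) set" where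
  "Y_frieze_patterns r A =
    {k \<in> ({1..r} \<times> UNIV) \<rightarrow>\<^sub>E {n. 0 < n}.
      \<forall>i\<in>{1..r}. \<forall>m. k (i, m) * k (i, m + 1) =
        (\<Prod>j\<in>{i<..r}. (1 + k (j, m)) ^ nat (- A j i)) *
        (\<Prod>j\<in>{1..<i}. (1 + k (j, m + 1)) ^ nat (- A j i))}"

text \<open>Finite type: \<open>A\<close> has a symmetrisation \<open>D A\<close>, with \<open>D\<close> a positive diagonal matrix, that is
  positive definite.\<close>

definition finite_type :: "nat \<Rightarrow> (nat \<Rightarrow> nat \<Rightarrow> int) \<Rightarrow> bool" where
  "finite_type r A \<longleftrightarrow>
    (\<exists>d :: nat \<Rightarrow> real.
      (\<forall>i\<in>{1..r}. 0 < d i) \<and>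
      (\<forall>i\<in>{1..r}. \<forall>j\<in>{1..r}. d i * of_int (A i j) = d j * of_int (A j i)) \<and>
      (\<forall>x :: nat \<Rightarrow> real. (\<exists>i\<in>{1..r}. x i \<noteq> 0) \<longrightarrow>
        0 < (\<Sum>i\<in>{1..r}. \<Sum>j\<in>{1..r}. x i * (d i * of_int (A i j)) * x j)))"

text \<open>Cartan matrices have the same type if they agree up to a relabelling of the indices; in
  particular \<open>B\<^sub>2 = C\<^sub>2\<close>.\<close>

definition same_type :: "nat \<Rightarrow> (nat \<Rightarrow> nat \<Rightarrow> int) \<Rightarrow> (nat \<Rightarrow> nat \<Rightarrow> int) \<Rightarrow> bool" where
  "same_type r A B \<longleftrightarrow>
    (\<exists>p. bij_betw p {1..r} {1..r} \<and> (\<forall>i\<in>{1..r}. \<forall>j\<in>{1..r}. A (p i) (p j) = B i j))"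

abbreviation "type_A2 A \<equiv> same_type 2 A (cartan2 1 1)"
abbreviation "type_C2 A \<equiv> same_type 2 A (cartan2 2 1)"
abbreviation "type_G2 A \<equiv> same_type 2 A (cartan2 3 1)"

end

theory Submission
  imports Defs
begin

text \<open>
  In finite type \<open>(b, c) = (d, 1)\<close> the second row is \<open>k(2,m) = k(1,m) k(1,m+1) - 1\<close>, so a pattern
  is a bi-infinite sequence \<open>u\<close> of positive integers, determined by \<open>u 0\<close> and \<open>u 1\<close>. The sequence is
  periodic of period 5, 3, 4 for \<open>d = 1, 2, 3\<close>. For \<open>d = 2\<close> the period solves \<open>x y z = x + y + z + 2\<close>.
  For \<open>d = 3\<close> it solves \<open>x z = y + w + 3\<close> and \<open>y w = x + z + 3\<close>, whence
  \<open>(x - 1)(z - 1) + (y - 1)(w - 1) = 8\<close>, which leaves finitely many cases.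

  If \<open>b c \<ge> 4\<close>, the first row of any pattern satisfies \<open>k(1,m) k(1,m+2) > k(1,m+1)\<^sup>2\<close>, so it has no
  maximum, and the translates of one pattern form an infinite family. A pattern exists by the
  Laurent phenomenon: if \<open>a (n-1) a (n+1) = 1 + (a n) ^ e n\<close>, then the powers \<open>(a n) ^ e n\<close> satisfy
  the equations of a \<open>Y\<close>-frieze.
\<close>

section \<open>Patterns as pairs of rows, and the symmetries of the equations\<close>

definition frieze_rows :: "nat \<Rightarrow> nat \<Rightarrow> ((int \<Rightarrow> nat) \<times> (int \<Rightarrow> nat)) set" where
  "frieze_rows b c = {(u, v). \<forall>m. 0 < u m \<and> 0 < v m \<and>
     u m * u (m + 1) = (1 + v m) ^ c \<and> v m * v (m + 1) = (1 + u (m + 1)) ^ b}"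

lemma Y_frieze_patterns_cartan2:
  "k \<in> Y_frieze_patterns 2 (cartan2 b c) \<longleftrightarrow>
     k \<in> extensional ({1..2} \<times> UNIV) \<and> (\<lambda>m. k (1, m), \<lambda>m. k (2, m)) \<in> frieze_rows b c"
proof -
  have "{1..2::nat} = {1, 2}" "{1<..2::nat} = {2}" "{1..<2::nat} = {1}" "{2<..2::nat} = {}"
    by auto
  then show ?thesis
    unfolding Y_frieze_patterns_def frieze_rows_def
    by (auto simp: cartan2_def PiE_iff)
qed

lemma bij_betw_frieze_rows:
  "bij_betw (\<lambda>k. (\<lambda>m. k (1, m), \<lambda>m. k (2, m))) (Y_frieze_patterns 2 (cartan2 b c)) (frieze_rows b c)"
proof -
  define g :: "(int \<Rightarrow> nat) \<times> (int \<Rightarrow> nat) \<Rightarrow> nat \<times> int \<Rightarrow> nat" where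
    "g = (\<lambda>(u, v). restrict (\<lambda>(i, m). if i = 1 then u m else v m) ({1..2} \<times> UNIV))"
  have g: "(\<lambda>m. g uv (1, m)) = fst uv" "(\<lambda>m. g uv (2, m)) = snd uv"
    "g uv \<in> extensional ({1..2} \<times> UNIV)" for uv
    by (auto simp: g_def split: prod.split)
  have "g (\<lambda>m. k (1, m), \<lambda>m. k (2, m)) = k" if "k \<in> extensional ({1..2} \<times> UNIV)" for k
  proof (rule extensionalityI[OF g(3) that])
    fix im :: "nat \<times> int" assume "im \<in> {1..2} \<times> UNIV"
    then obtain i m where "im = (i, m)" "i = 1 \<or> i = 2"
      by (cases im) force
    then show "g (\<lambda>m. k (1, m), \<lambda>m. k (2, m)) im = k im"
      by (auto simp: g_def)
  qed
  then show ?thesis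
    by (intro bij_betw_byWitness[where f' = g])
      (auto simp: Y_frieze_patterns_cartan2 g[unfolded One_nat_def])
qed

text \<open>The second equation at \<open>m\<close> involves \<open>u (m + 1)\<close>, so in the
  interleaved order of the two rows the successor of \<open>v m\<close> is \<open>u (m + 1)\<close>;
  hence the shift.\<close>

lemma frieze_rows_swap:
  "(u, v) \<in> frieze_rows b c \<Longrightarrow> (v, \<lambda>m. u (m + 1)) \<in> frieze_rows c b"
  by (auto simp only: frieze_rows_def mem_Collect_eq case_prod_conv)

lemma frieze_rows_translate:
  "(u, v) \<in> frieze_rows b c \<Longrightarrow> (\<lambda>m. u (m + t), \<lambda>m. v (m + t)) \<in> frieze_rows b c"
proof -
  have "m + 1 + t = m + t + 1" for m
    by simp
  then show "(u, v) \<in> frieze_rows b c \<Longrightarrow> ?thesis"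
    by (auto simp only: frieze_rows_def mem_Collect_eq case_prod_conv)
qed

text \<open>Reduces the parameters \<open>(1, d)\<close> to \<open>(d, 1)\<close>, the only form
  counted in finite type.\<close>

lemma card_frieze_rows_swap: "card (frieze_rows b c) = card (frieze_rows c b)"
proof -
  define h :: "(int \<Rightarrow> nat) \<times> (int \<Rightarrow> nat) \<Rightarrow> (int \<Rightarrow> nat) \<times> (int \<Rightarrow> nat)" where
    "h = (\<lambda>(v, w). (\<lambda>m. w (m - 1), v))"
  have "h (v, w) \<in> frieze_rows b c" if "(v, w) \<in> frieze_rows c b" for v w
    using frieze_rows_translate[OF frieze_rows_swap[OF that], of "- 1"] by (simp add: h_def)
  then have "bij_betw (\<lambda>(u, v). (v, \<lambda>m. u (m + 1))) (frieze_rows b c) (frieze_rows c b)"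
    by (intro bij_betw_byWitness[where f' = h]) (auto simp: frieze_rows_swap h_def)
  then show ?thesis
    by (rule bij_betw_same_card)
qed


section \<open>Infinite type\<close>

text \<open>Cluster variables of the rank 2 cluster algebra with exponents \<open>b\<close> and
  \<open>c\<close>, both initial variables set to 1. For positive \<open>b\<close> and
  \<open>c\<close> the division is exact, by \<open>cluster_seq_exchange\<close>.\<close>

fun cluster_seq :: "nat \<Rightarrow> nat \<Rightarrow> nat \<Rightarrow> nat" where
  "cluster_seq b c 0 = 1"
| "cluster_seq b c (Suc 0) = 1"
| "cluster_seq b c (Suc (Suc n)) =
     (1 + cluster_seq b c (Suc n) ^ (if even n then b else c)) div cluster_seq b c n"

text \<open>Modulo \<open>q\<close>, \<open>p ^ e * (1 + r ^ e) = p ^ e + (1 + q ^ f) ^ e = p ^ e + 1 = 0\<close>, and \<open>p\<close> is a unit.\<close>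

lemma exchange_dvd:
  fixes p q r x e f :: nat
  assumes "x * q = 1 + p ^ e" "p * r = 1 + q ^ f" "0 < e" "0 < f"
  shows "q dvd 1 + r ^ e"
proof -
  have "coprime q (p ^ e)"
  proof (rule coprimeI)
    fix z assume "z dvd q" "z dvd p ^ e"
    then have "z dvd 1 + p ^ e" "z dvd p ^ e"
      using assms(1) by (metis dvd_mult, blast)
    then show "z dvd 1"
      using dvd_add_left_iff by blast
  qed
  moreover have "q dvd p ^ e * (1 + r ^ e)"
  proof -
    have "(1 + q ^ f) mod q = 1 mod q"
      using assms(4) by (cases f) (simp_all only: power_Suc mod_mult_self2 less_irrefl)
    then have "(1 + q ^ f) ^ e mod q = 1 mod q"
      by (metis power_mod power_one)
    then have "(p ^ e + (1 + q ^ f) ^ e) mod q = (p ^ e + 1) mod q"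
      by (metis mod_add_right_eq)
    also have "\<dots> = 0"
      by (metis add.commute assms(1) mod_mult_self2_is_0)
    finally have "q dvd p ^ e + (p * r) ^ e"
      using assms(2) by (simp add: dvd_eq_mod_eq_0)
    then show ?thesis
      by (simp add: algebra_simps power_mult_distrib)
  qed
  ultimately show ?thesis
    by (simp only: coprime_dvd_mult_right_iff)
qed

lemma cluster_seq_exchange:
  assumes "0 < b" "0 < c"
  shows "cluster_seq b c n * cluster_seq b c (n + 2) =
    1 + cluster_seq b c (n + 1) ^ (if even n then b else c)"
proof (induction n rule: less_induct)
  case (less n)
  have "cluster_seq b c n dvd 1 + cluster_seq b c (n + 1) ^ (if even n then b else c)"
  proof (cases "n < 2")
    case True
    then show ?thesis
      by (auto simp: less_2_cases_iff)
  next
    case False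
    then obtain m where m: "n = Suc (Suc m)"
      by (metis One_nat_def Suc_pred less_2_cases_iff neq0_conv not_gr_zero old.nat.exhaust)
    \<comment> \<open>The exponents alternate, so \<open>n = m + 2\<close> has the exponent of
      \<open>m\<close>; the exchange relations at \<open>m\<close> and \<open>m + 1\<close> are the
      first two hypotheses of \<open>exchange_dvd\<close>.\<close>
    show ?thesis
      by (rule exchange_dvd[of "cluster_seq b c m" _ "cluster_seq b c (m + 1)" _ _
            "if even m then c else b"])
        (use less.IH[of m] less.IH[of "m + 1"] assms m in \<open>auto simp del: cluster_seq.simps\<close>)
  qed
  then show ?case
    by simp
qed

lemma cluster_seq_pos: "0 < b \<Longrightarrow> 0 < c \<Longrightarrow> 0 < cluster_seq b c n"
  using cluster_seq_exchange[of b c n] by (cases "cluster_seq b c n") auto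

lemma frieze_rows_nonempty:
  assumes "0 < b" "0 < c"
  shows "frieze_rows b c \<noteq> {}"
proof -
  \<comment> \<open>Sending \<open>n\<close> to \<open>1 - n\<close> reverses parity, hence
    exchanges \<open>b\<close> and \<open>c\<close>, and preserves the initial pair of ones. This
    extends the sequence to negative indices.\<close>
  define a where "a n = (if 0 \<le> n then cluster_seq b c (nat n) else cluster_seq c b (nat (1 - n)))"
    for n :: int
  \<comment> \<open>Both formulas give 1 at 0 and at 1, so the relation at \<open>n = - 1\<close>,
    which reaches \<open>n + 2 = 1\<close>, can be read entirely on the reflected side.\<close>
  have neg: "a n = cluster_seq c b (nat (1 - n))" if "n \<le> 1" for n
  proof -
    have "n < 0 \<or> n = 0 \<or> n = 1"
      using that by linarith
    then show ?thesis
      by (auto simp: a_def)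
  qed
  have a: "a n * a (n + 2) = 1 + a (n + 1) ^ (if even n then b else c)" for n
  proof (cases "0 \<le> n")
    case True
    then have "nat (n + 2) = nat n + 2" "nat (n + 1) = nat n + 1" "even (nat n) = even n"
      by (auto simp: even_nat_iff)
    with True show ?thesis
      using cluster_seq_exchange[OF assms, of "nat n"]
      by (simp add: a_def del: cluster_seq.simps)
  next
    case False
    define j where "j = nat (- 1 - n)"
    have "nat (1 - (n + 2)) = j" "nat (1 - (n + 1)) = j + 1" "nat (1 - n) = j + 2"
      "even j = odd n"
      using False by (auto simp: j_def even_nat_iff)
    with False show ?thesis
      using cluster_seq_exchange[OF assms(2,1), of j] neg[of n] neg[of "n + 1"] neg[of "n + 2"]
      by (simp add: mult.commute del: cluster_seq.simps)
  qed
  have pos: "0 < a n" for n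
    using assms by (simp add: a_def cluster_seq_pos)
  have "a (2 * m) ^ c * a (2 * (m + 1)) ^ c = (1 + a (2 * m + 1) ^ b) ^ c" for m
    using a[of "2 * m"] by (simp add: power_mult_distrib[symmetric] algebra_simps)
  moreover have "a (2 * m + 1) ^ b * a (2 * (m + 1) + 1) ^ b = (1 + a (2 * (m + 1)) ^ c) ^ b" for m
    using a[of "2 * m + 1"] by (simp add: power_mult_distrib[symmetric] algebra_simps)
  ultimately have "(\<lambda>m. a (2 * m) ^ c, \<lambda>m. a (2 * m + 1) ^ b) \<in> frieze_rows b c"
    using pos by (simp add: frieze_rows_def)
  then show ?thesis
    by blast
qed

text \<open>The product of the first-row equations at \<open>m\<close> and \<open>m + 1\<close>
  exceeds \<open>(v m * v (m + 1)) ^ c = (1 + u (m + 1)) ^ (b * c)\<close>, which is at least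
  \<open>u (m + 1) ^ 4\<close>; then \<open>u (m + 1) ^ 2\<close> cancels.\<close>

lemma frieze_rows_log_convex:
  assumes "(u, v) \<in> frieze_rows b c" "0 < c" "4 \<le> b * c"
  shows "u (m + 1) ^ 2 < u m * u (m + 2)"
proof -
  have uv: "0 < u m" "0 < v m" "u m * u (m + 1) = (1 + v m) ^ c"
    "v m * v (m + 1) = (1 + u (m + 1)) ^ b" for m
    using assms(1) by (auto simp: frieze_rows_def)
  have "u (m + 1) ^ 4 \<le> (1 + u (m + 1)) ^ 4"
    by (intro power_mono) auto
  also have "\<dots> \<le> (1 + u (m + 1)) ^ (b * c)"
    using assms(3) by (intro power_increasing) auto
  also have "\<dots> = (v m * v (m + 1)) ^ c"
    by (simp add: uv(4) power_mult)
  also have "\<dots> < ((1 + v m) * (1 + v (m + 1))) ^ c"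
    using assms(2) by (intro power_strict_mono) auto
  also have "\<dots> = (u m * u (m + 1)) * (u (m + 1) * u (m + 2))"
    using uv(3)[of m] uv(3)[of "m + 1"] unfolding power_mult_distrib by (simp add: add.assoc)
  also have "\<dots> = u (m + 1) ^ 2 * (u m * u (m + 2))"
    by (simp add: power2_eq_square)
  also have "u (m + 1) ^ 4 = u (m + 1) ^ 2 * u (m + 1) ^ 2"
    by (simp flip: power_add)
  finally show ?thesis
    by (simp only: mult_less_cancel1)
qed

lemma infinite_frieze_rows:
  assumes "0 < b" "0 < c" "4 \<le> b * c"
  shows "infinite (frieze_rows b c)"
proof
  assume fin: "finite (frieze_rows b c)"
  obtain u v where uv: "(u, v) \<in> frieze_rows b c"
    using frieze_rows_nonempty[OF assms(1,2)] by auto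
  \<comment> \<open>Each value \<open>u t\<close> is the value at 0 of a translate, so finitely many
    patterns would leave \<open>u\<close> only finitely many values.\<close>
  have "u t \<in> (\<lambda>(u, v). u 0) ` frieze_rows b c" for t
    using frieze_rows_translate[OF uv, of t] by (force intro: rev_image_eqI)
  then have fin_u: "finite (range u)"
    using fin by (meson finite_imageI finite_subset image_subsetI)
  then obtain n where n: "u n = Max (range u)"
    using Max_in by (metis UNIV_not_empty imageE image_is_empty)
  then have "u m \<le> u n" for m
    using fin_u by simp
  then have "u (n - 1) * u (n + 1) \<le> u n ^ 2"
    by (simp add: power2_eq_square mult_le_mono)
  then show False
    using frieze_rows_log_convex[OF uv assms(2,3), of "n - 1"] by (simp add: add.commute)
qed


section \<open>Finite type\<close>

text \<open>The right-hand side is positive, so the truncated subtractions force \<open>u m * u (m + 1) > 1\<close>.\<close>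

definition first_rows :: "nat \<Rightarrow> (int \<Rightarrow> nat) set" where
  "first_rows d = {u. \<forall>m. 0 < u m \<and>
     (u m * u (m + 1) - 1) * (u (m + 1) * u (m + 2) - 1) = (1 + u (m + 1)) ^ d}"

lemma first_rows_gt_1:
  assumes "u \<in> first_rows d"
  shows "1 < u m * u (m + 1)"
proof (rule ccontr)
  assume "\<not> ?thesis"
  then have "u m * u (m + 1) - 1 = 0"
    by simp
  moreover have "(u m * u (m + 1) - 1) * (u (m + 1) * u (m + 2) - 1) = (1 + u (m + 1)) ^ d"
    using assms by (simp add: first_rows_def)
  ultimately show False
    by simp
qed

lemma card_frieze_rows_first_rows: "card (frieze_rows d 1) = card (first_rows d)"
proof -
  have "bij_betw fst (frieze_rows d 1) (first_rows d)"
  proof (rule bij_betw_byWitness[where f' = "\<lambda>u. (u, \<lambda>m. u m * u (m + 1) - 1)"])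
    have "u \<in> first_rows d" if "(u, v) \<in> frieze_rows d 1" for u v
    proof -
      have uv: "0 < u m" "u m * u (m + 1) = Suc (v m)" "v m * v (m + 1) = (1 + u (m + 1)) ^ d" for m
        using that by (auto simp: frieze_rows_def)
      then have "u (m + 1) * u (m + 2) = Suc (v (m + 1))" for m
        using uv(2)[of "m + 1"] by (simp add: add.assoc)
      with uv show ?thesis
        by (simp add: first_rows_def)
    qed
    then show "fst ` frieze_rows d 1 \<subseteq> first_rows d"
      by auto
    show "(\<lambda>u. (u, \<lambda>m. u m * u (m + 1) - 1)) ` first_rows d \<subseteq> frieze_rows d 1"
      using first_rows_gt_1 by (force simp: frieze_rows_def first_rows_def add.assoc)
  qed (auto simp: frieze_rows_def)
  then show ?thesis
    by (rule bij_betw_same_card)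
qed

text \<open>The recurrence can be solved in both directions: the known factor is positive and
  cancels, and truncated subtraction of 1 is injective on products exceeding 1.\<close>

lemma first_rows_eqI:
  assumes "u \<in> first_rows d" "w \<in> first_rows d" "u 0 = w 0" "u 1 = w 1"
  shows "u = w"
proof -
  have rec: "(u m * u (m + 1) - 1) * (u (m + 1) * u (m + 2) - 1) = (1 + u (m + 1)) ^ d"
    if "u \<in> first_rows d" for u m
    using that by (simp add: first_rows_def)
  have gt: "1 < u m * u (m + 1)" "1 < w m * w (m + 1)" for m
    using assms first_rows_gt_1 by blast+
  have up: "u (m + 2) = w (m + 2)" if "u m = w m" "u (m + 1) = w (m + 1)" for m
  proof -
    have "(u m * u (m + 1) - 1) * (u (m + 1) * u (m + 2) - 1) =
          (u m * u (m + 1) - 1) * (u (m + 1) * w (m + 2) - 1)"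
      using rec[OF assms(1), of m] rec[OF assms(2), of m] that by simp
    then have "u (m + 1) * u (m + 2) - 1 = u (m + 1) * w (m + 2) - 1"
      using gt(1)[of m] by simp
    then have "u (m + 1) * u (m + 2) = u (m + 1) * w (m + 2)"
      using gt[of "m + 1"] unfolding add.assoc one_add_one that by linarith
    then show ?thesis
      using gt(1)[of m] by auto
  qed
  have down: "u m = w m" if "u (m + 2) = w (m + 2)" "u (m + 1) = w (m + 1)" for m
  proof -
    have "(u m * u (m + 1) - 1) * (u (m + 1) * u (m + 2) - 1) =
          (w m * u (m + 1) - 1) * (u (m + 1) * u (m + 2) - 1)"
      using rec[OF assms(1), of m] rec[OF assms(2), of m] that by simp
    then have "u m * u (m + 1) - 1 = w m * u (m + 1) - 1"
      using gt(1)[of "m + 1"] by (simp add: add.assoc)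
    then have "u m * u (m + 1) = w m * u (m + 1)"
      using gt[of m] unfolding that by linarith
    then show ?thesis
      using gt(1)[of m] by auto
  qed
  have "u m = w m \<and> u (m + 1) = w (m + 1)" for m
  proof (induction m rule: int_induct[where k = 0])
    case (step1 m)
    then show ?case
      using up[of m] by (simp add: add.assoc)
  next
    case (step2 m)
    then show ?case
      using down[of "m - 1"] by (simp add: add.commute)
  qed (use assms in auto)
  then show ?thesis
    by blast
qed

section \<open>Periodic sequences and counting by initial values\<close>

definition cyclic_seq :: "'a list \<Rightarrow> int \<Rightarrow> 'a" where
  "cyclic_seq xs m = xs ! nat (m mod int (length xs))"

text \<open>Only positions of the list are tested, so concrete lists can be checked by
  evaluation.\<close>

definition is_period :: "nat \<Rightarrow> nat list \<Rightarrow> bool" where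
  "is_period d xs \<longleftrightarrow> (\<forall>i<length xs. 0 < xs ! i \<and>
     (xs ! i * xs ! (Suc i mod length xs) - 1) *
     (xs ! (Suc i mod length xs) * xs ! (Suc (Suc i) mod length xs) - 1) =
     (1 + xs ! (Suc i mod length xs)) ^ d)"

lemma cyclic_seq_in_first_rows:
  assumes "is_period d xs" "xs \<noteq> []"
  shows "cyclic_seq xs \<in> first_rows d"
proof -
  let ?n = "length xs"
  {
    fix m :: int
    define i where "i = nat (m mod int ?n)"
    have i: "i < ?n" "int i = m mod int ?n"
      using assms(2) by (auto simp: i_def nat_less_iff)
    have shift: "nat ((m + int t) mod int ?n) = (i + t) mod ?n" for t
    proof -
      have "(m + int t) mod int ?n = int ((i + t) mod ?n)"
        by (simp add: zmod_int i(2) mod_add_left_eq)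
      then show ?thesis
        by simp
    qed
    have "cyclic_seq xs m = xs ! i" "cyclic_seq xs (m + 1) = xs ! (Suc i mod ?n)"
      "cyclic_seq xs (m + 2) = xs ! (Suc (Suc i) mod ?n)"
      using shift[of 1] shift[of 2] by (simp_all add: cyclic_seq_def i_def[symmetric])
    with assms(1) i(1) have "0 < cyclic_seq xs m \<and>
      (cyclic_seq xs m * cyclic_seq xs (m + 1) - 1) *
      (cyclic_seq xs (m + 1) * cyclic_seq xs (m + 2) - 1) = (1 + cyclic_seq xs (m + 1)) ^ d"
      by (simp add: is_period_def)
  }
  then show ?thesis
    by (simp add: first_rows_def)
qed

definition seed :: "'a list \<Rightarrow> 'a \<times> 'a" where
  "seed xs = (xs ! 0, xs ! (1 mod length xs))"

text \<open>Initial pairs determine the sequences, so a list of periods gives the count once its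
  seeds are distinct and exhaust the possible initial pairs.\<close>

lemma card_first_rows:
  assumes periods: "\<forall>xs\<in>set xss. xs \<noteq> [] \<and> is_period d xs"
    and distinct: "distinct (map seed xss)"
    and complete: "\<And>u. u \<in> first_rows d \<Longrightarrow> (u 0, u 1) \<in> set (map seed xss)"
  shows "card (first_rows d) = length xss"
proof -
  have "inj_on (\<lambda>u. (u 0, u 1)) (first_rows d)"
    by (rule inj_onI) (auto intro: first_rows_eqI)
  moreover have "(\<lambda>u. (u 0, u 1)) ` first_rows d = set (map seed xss)"
  proof
    show "set (map seed xss) \<subseteq> (\<lambda>u. (u 0, u 1)) ` first_rows d"
    proof clarsimp
      fix xs assume "xs \<in> set xss"
      then have "cyclic_seq xs \<in> first_rows d"
        using periods cyclic_seq_in_first_rows by blast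
      moreover have "nat (1 mod int (length xs)) = 1 mod length xs"
        by (metis nat_int of_nat_1 zmod_int)
      ultimately show "seed xs \<in> (\<lambda>u. (u 0, u 1)) ` first_rows d"
        by (intro image_eqI[where x = "cyclic_seq xs"]) (simp_all add: cyclic_seq_def seed_def)
    qed
  qed (use complete in blast)
  ultimately show ?thesis
    by (metis card_image distinct distinct_card length_map)
qed

text \<open>Over the integers the subtractions are exact, so the recurrence can be expanded by ring
  arithmetic.\<close>

lemma first_rows_int:
  assumes "u \<in> first_rows d"
  shows "(int (u m) * int (u (m + 1)) - 1) * (int (u (m + 1)) * int (u (m + 2)) - 1) =
    (1 + int (u (m + 1))) ^ d"
proof -
  have "int (u m * u (m + 1) - 1) = int (u m) * int (u (m + 1)) - 1" for m
    using first_rows_gt_1[OF assms, of m] by (simp only: of_nat_diff less_imp_le of_nat_mult of_nat_1)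
  from this[of m] this[of "m + 1"]
  have "int ((u m * u (m + 1) - 1) * (u (m + 1) * u (m + 2) - 1)) =
    (int (u m) * int (u (m + 1)) - 1) * (int (u (m + 1)) * int (u (m + 2)) - 1)"
    unfolding of_nat_mult add.assoc one_add_one by simp
  moreover have "int ((u m * u (m + 1) - 1) * (u (m + 1) * u (m + 2) - 1)) = int ((1 + u (m + 1)) ^ d)"
    using assms by (simp add: first_rows_def)
  ultimately show ?thesis
    by simp
qed

section \<open>Type A2: period 5\<close>

lemma A2_bound:
  fixes x y w :: nat
  assumes "x * y * w = y + w + 1" "0 < y" "0 < w"
  shows "x \<le> 3"
proof (rule ccontr)
  assume "\<not> x \<le> 3"
  obtain s t where st: "y = Suc s" "w = Suc t"
    using assms(2,3) gr0_conv_Suc by metis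
  \<comment> \<open>Substituting \<open>y = 1 + s\<close> and \<open>w = 1 + t\<close> leaves a sum
    of nonnegative terms, one of which is \<open>x\<close>.\<close>
  then have "x + (x - 1) * (s + t) + x * (s * t) = 3"
    using assms(1) \<open>\<not> x \<le> 3\<close> by (cases x) (simp_all add: algebra_simps)
  with \<open>\<not> x \<le> 3\<close> show False
    by linarith
qed

lemma card_first_rows_A2: "card (first_rows 1) = 5"
proof -
  \<comment> \<open>The five rotations of a single period.\<close>
  let ?xss = "[[1,2,2,1,3], [2,2,1,3,1], [2,1,3,1,2], [1,3,1,2,2], [3,1,2,2,1]] :: nat list list"
  have "card (first_rows 1) = length ?xss"
  proof (rule card_first_rows)
    show "\<forall>xs\<in>set ?xss. xs \<noteq> [] \<and> is_period 1 xs"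
      by code_simp
    show "distinct (map seed ?xss)"
      by code_simp
  next
    fix u assume u: "u \<in> first_rows 1"
    \<comment> \<open>The recurrence centred at 1 bounds \<open>y\<close>; the one centred at 0,
      which needs \<open>u (- 1)\<close>, bounds \<open>x\<close>.\<close>
    define z x y w where "z = u (- 1)" and "x = u 0" and "y = u 1" and "w = u 2"
    have pos: "0 < z" "0 < x" "0 < y" "0 < w"
      using u by (auto simp: z_def x_def y_def w_def first_rows_def)
    have "int y * int (x * y * w) = int y * int (x + w + 1)"
      using first_rows_int[OF u, of 0] by (simp add: x_def y_def w_def algebra_simps)
    then have e1: "x * y * w = x + w + 1"
      using pos by (simp only: mult_cancel_left of_nat_eq_iff) simp
    have "int x * int (z * x * y) = int x * int (z + y + 1)"
      using first_rows_int[OF u, of "- 1"] by (simp add: x_def y_def z_def algebra_simps)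
    then have e2: "z * x * y = z + y + 1"
      using pos by (simp only: mult_cancel_left of_nat_eq_iff) simp
    have "x \<in> set [1..<4]" "y \<in> set [1..<4]"
      using A2_bound[of y x w] A2_bound[of x y z] e1 e2 pos
      by (auto simp: ac_simps)
    \<comment> \<open>Solving \<open>e1\<close> for \<open>w\<close> turns its existence into a
      divisibility in \<open>x\<close> and \<open>y\<close>, leaving a finite search.\<close>
    moreover have "x * y - 1 dvd x + 1"
      by (rule dvdI[of _ _ w]) (use e1 in \<open>simp add: algebra_simps\<close>)
    moreover have "\<forall>x\<in>set [1..<4]. \<forall>y\<in>set [1..<4]. x * y - 1 dvd x + 1 \<longrightarrow>
      (x, y) \<in> set (map seed ?xss)"
      by code_simp
    ultimately show "(u 0, u 1) \<in> set (map seed ?xss)"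
      unfolding x_def y_def by blast
  qed
  then show ?thesis
    by simp
qed

section \<open>Type C2: period 3\<close>

lemma C2_bound:
  fixes x y w :: nat
  assumes "x * y * w = x + y + w + 2" "0 < y" "0 < w"
  shows "x \<le> 5"
proof (rule ccontr)
  assume "\<not> x \<le> 5"
  obtain s t where st: "y = Suc s" "w = Suc t"
    using assms(2,3) gr0_conv_Suc by metis
  \<comment> \<open>The second factor cannot vanish, since then \<open>s * t = 0\<close> and the
    left side would be 0; hence \<open>x - 1\<close> is at most 4.\<close>
  then have e: "(x - 1) * (s * t + s + t) + s * t = 4"
    using assms(1) \<open>\<not> x \<le> 5\<close> by (cases x) (simp_all add: algebra_simps)
  moreover have "0 < s * t + s + t"
    using e by (intro gr0I) simp
  then have "x - 1 \<le> (x - 1) * (s * t + s + t)"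
    using mult_le_mono2[of 1 "s * t + s + t" "x - 1"] by linarith
  ultimately show False
    using \<open>\<not> x \<le> 5\<close> by linarith
qed

lemma card_first_rows_C2: "card (first_rows 2) = 10"
proof -
  \<comment> \<open>All orderings of (2,2,2), (1,3,3) and (1,2,5). The equation for the period
    amounts to 1/(1+x) + 1/(1+y) + 1/(1+z) = 1.\<close>
  let ?xss = "[[2,2,2], [1,3,3], [3,1,3], [3,3,1],
    [1,2,5], [1,5,2], [2,1,5], [2,5,1], [5,1,2], [5,2,1]] :: nat list list"
  have "card (first_rows 2) = length ?xss"
  proof (rule card_first_rows)
    show "\<forall>xs\<in>set ?xss. xs \<noteq> [] \<and> is_period 2 xs"
      by code_simp
    show "distinct (map seed ?xss)"
      by code_simp
  next
    fix u assume u: "u \<in> first_rows 2"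
    define x y w where "x = u 0" and "y = u 1" and "w = u 2"
    have pos: "0 < x" "0 < y" "0 < w"
      using u by (auto simp: x_def y_def w_def first_rows_def)
    have "int y * int (x * y * w) = int y * int (x + y + w + 2)"
      using first_rows_int[OF u, of 0]
      by (simp add: x_def y_def w_def algebra_simps power2_eq_square)
    then have e: "x * y * w = x + y + w + 2"
      using pos by (simp only: mult_cancel_left of_nat_eq_iff) simp
    then have "x \<in> set [1..<6]" "y \<in> set [1..<6]"
      using C2_bound[of x y w] C2_bound[of y x w] pos by (simp_all add: ac_simps)
    moreover have "x * y - 1 dvd x + y + 2"
      by (rule dvdI[of _ _ w]) (use e in \<open>simp add: algebra_simps\<close>)
    moreover have "\<forall>x\<in>set [1..<6]. \<forall>y\<in>set [1..<6]. x * y - 1 dvd x + y + 2 \<longrightarrow>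
      (x, y) \<in> set (map seed ?xss)"
      by code_simp
    ultimately show "(u 0, u 1) \<in> set (map seed ?xss)"
      unfolding x_def y_def by blast
  qed
  then show ?thesis
    by simp
qed

section \<open>Type G2: period 4\<close>

lemma G2_bound:
  fixes x y z w :: nat
  assumes "x * z = y + w + 3" "y * w = x + z + 3"
  shows "x \<le> 14"
proof (rule ccontr)
  assume x: "\<not> x \<le> 14"
  have "x * z \<noteq> 0" "y * w \<noteq> 0"
    unfolding assms by simp_all
  then have "z \<noteq> 0" "y \<noteq> 0" "w \<noteq> 0"
    by auto
  then obtain p q s t where st: "x = Suc p" "z = Suc q" "y = Suc s" "w = Suc t"
    using x by (metis not0_implies_Suc le0)
  have e: "p * q + s * t = 8"
    using assms by (simp add: st algebra_simps)
  \<comment> \<open>As \<open>p\<close> exceeds 8, \<open>e\<close> forces \<open>z = 1\<close>.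
    Then \<open>x = s + t + 5\<close> with \<open>s * t = 8\<close>, and \<open>s + t\<close> is
    largest for the factors 1 and 8, giving 14.\<close>
  have "q = 0"
  proof (rule ccontr)
    assume "q \<noteq> 0"
    then have "p \<le> p * q" by simp
    with e x st show False by linarith
  qed
  with e have "s * t = 8" by simp
  moreover have "x = y + w + 3"
    using assms(1) st \<open>q = 0\<close> by simp
  moreover have "s + t \<le> 9"
  proof -
    have "s * t \<noteq> 0"
      unfolding \<open>s * t = 8\<close> by simp
    then have "s \<noteq> 0" "t \<noteq> 0"
      by auto
    then obtain s' t' where "s = Suc s'" "t = Suc t'"
      using not0_implies_Suc by blast
    then show ?thesis
      using \<open>s * t = 8\<close> by simp
  qed
  ultimately show False
    using st x by linarith
qed

text \<open>\<open>x * z - 3 - y\<close> is the second root of the quadratic equation for \<open>y\<close> given by the recurrence,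
  and it satisfies the same linear equation as the next term \<open>w\<close>.\<close>

lemma G2_square:
  fixes x y z w :: int
  assumes "(x * y - 1) * (y * z - 1) = (1 + y) ^ 3" "(y * z - 1) * (z * w - 1) = (1 + z) ^ 3"
    and "0 < y" "0 < z" "1 < y * z"
  shows "x * z = y + w + 3" "y * w = x + z + 3"
proof -
  have "y * (y * (x * z - 3 - y)) = y * (x + z + 3)"
    using assms(1) by (simp add: algebra_simps power3_eq_cube)
  then have r: "y * (x * z - 3 - y) = x + z + 3"
    using assms(3) by simp
  have "z * ((y * z - 1) * w) = z * (y + z ^ 2 + 3 * z + 3)"
    using assms(2) by (simp add: algebra_simps power3_eq_cube power2_eq_square)
  then have "(y * z - 1) * w = y + z ^ 2 + 3 * z + 3"
    using assms(4) by simp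
  also have "\<dots> = (y * z - 1) * (x * z - 3 - y)"
    using r by algebra
  finally have w: "w = x * z - 3 - y"
    using assms(5) by simp
  then show "x * z = y + w + 3" "y * w = x + z + 3"
    using r by simp_all
qed

lemma card_first_rows_G2: "card (first_rows 3) = 21"
proof -
  \<comment> \<open>Four rotations of each of five periods and one constant sequence give 21. The
    first two periods are reversals of each other, as are the next two.\<close>
  let ?rot = "\<lambda>xs. map (\<lambda>i. rotate i xs) [0..<4]"
  let ?xss = "concat (map ?rot [[14,2,1,9], [9,1,2,14], [11,3,1,5], [5,1,3,11], [5,2,2,5]]) @
    [[3,3,3,3]] :: nat list list"
  have "card (first_rows 3) = length ?xss"
  proof (rule card_first_rows)
    show "\<forall>xs\<in>set ?xss. xs \<noteq> [] \<and> is_period 3 xs"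
      by code_simp
    show "distinct (map seed ?xss)"
      by code_simp
  next
    fix u assume u: "u \<in> first_rows 3"
    define x y z w where "x = u 0" and "y = u 1" and "z = u 2" and "w = u 3"
    have pos: "0 < x" "0 < y" "0 < z" "0 < w" and gt: "1 < y * z"
      using u first_rows_gt_1[OF u, of 1]
      by (auto simp: x_def y_def z_def w_def first_rows_def)
    have "1 < int y * int z"
      using gt by (metis of_nat_1 of_nat_less_iff of_nat_mult)
    then have "int x * int z = int y + int w + 3" "int y * int w = int x + int z + 3"
      using G2_square[of "int x" "int y" "int z" "int w"] pos
        first_rows_int[OF u, of 0] first_rows_int[OF u, of 1]
      by (simp_all add: x_def y_def z_def w_def)
    then have "int (x * z) = int (y + w + 3)" "int (y * w) = int (x + z + 3)"
      by simp_all
    then have e: "x * z = y + w + 3" "y * w = x + z + 3"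
      by (simp_all only: of_nat_eq_iff)
    then have "x \<in> set [1..<15]" "y \<in> set [1..<15]"
      using G2_bound[of x z y w] G2_bound[of y w x z] pos by simp_all
    \<comment> \<open>Eliminating \<open>w\<close> from the two relations in \<open>e\<close>
      expresses \<open>z\<close> as a quotient in \<open>x\<close> and \<open>y\<close>.\<close>
    moreover have "x * y - 1 dvd x + y * y + 3 * y + 3"
    proof
      have "y * (x * z) = y * (y + w + 3)"
        using e(1) by simp
      then show "x + y * y + 3 * y + 3 = (x * y - 1) * z"
        using e(2) by (simp add: algebra_simps)
    qed
    moreover have "\<forall>x\<in>set [1..<15]. \<forall>y\<in>set [1..<15]. x * y - 1 dvd x + y * y + 3 * y + 3 \<longrightarrow>
      (x, y) \<in> set (map seed ?xss)"
      by code_simp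
    ultimately show "(u 0, u 1) \<in> set (map seed ?xss)"
      unfolding x_def y_def by blast
  qed
  then show ?thesis
    by simp
qed


section \<open>Cartan matrices\<close>

lemma finite_type_cartan2_quadratic_form:
  "finite_type 2 (cartan2 b c) \<longleftrightarrow> (\<exists>d :: nat \<Rightarrow> real. 0 < d 1 \<and> 0 < d 2 \<and> d 1 * b = d 2 * c \<and>
    (\<forall>x :: nat \<Rightarrow> real. x 1 \<noteq> 0 \<or> x 2 \<noteq> 0 \<longrightarrow>
      0 < 2 * d 1 * x 1 ^ 2 - (d 1 * b + d 2 * c) * x 1 * x 2 + 2 * d 2 * x 2 ^ 2))"
proof -
  have I: "{1..2::nat} = {1, 2}"
    by auto
  have "(\<Sum>i\<in>{1, 2}. \<Sum>j\<in>{1, 2}. x i * (d i * of_int (cartan2 b c i j)) * x j) =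
    2 * d 1 * x 1 ^ 2 - (d 1 * b + d 2 * c) * x 1 * x 2 + 2 * d 2 * x 2 ^ 2" for x d :: "nat \<Rightarrow> real"
    by (simp add: cartan2_def algebra_simps power2_eq_square)
  moreover have "(\<forall>i\<in>{1, 2}. \<forall>j\<in>{1, 2}. d i * of_int (cartan2 b c i j) = d j * of_int (cartan2 b c j i)) \<longleftrightarrow>
    d 1 * b = d 2 * c" for d :: "nat \<Rightarrow> real"
    by (auto simp: cartan2_def)
  ultimately show ?thesis
    unfolding finite_type_def I by (simp only: ball_simps bex_simps ball_empty bex_empty simp_thms conj_assoc)
qed

lemma finite_type_cartan2:
  assumes "0 < b" "0 < c"
  shows "finite_type 2 (cartan2 b c) \<longleftrightarrow> b * c \<le> 3"
proof
  assume "finite_type 2 (cartan2 b c)"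
  then obtain d :: "nat \<Rightarrow> real" where d: "0 < d 2" "d 1 * b = d 2 * c"
    and pd: "\<forall>x :: nat \<Rightarrow> real. x 1 \<noteq> 0 \<or> x 2 \<noteq> 0 \<longrightarrow>
      0 < 2 * d 1 * x 1 ^ 2 - (d 1 * b + d 2 * c) * x 1 * x 2 + 2 * d 2 * x 2 ^ 2"
    unfolding finite_type_cartan2_quadratic_form by metis
  \<comment> \<open>The test vector \<open>(b, 2)\<close> is annihilated by the first row of the
    matrix, so only the second row contributes.\<close>
  have "0 < 2 * d 1 * real b ^ 2 - (d 1 * b + d 2 * c) * real b * 2 + 2 * d 2 * 2 ^ 2"
    using pd[rule_format, of "\<lambda>i. if i = 1 then b else 2"] by simp
  also have "\<dots> = 2 * d 2 * (4 - real b * real c)"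
    using d(2) by algebra
  finally have "real (b * c) < 4"
    using d(1) by (simp add: zero_less_mult_iff)
  then show "b * c \<le> 3"
    by linarith
next
  assume le: "b * c \<le> 3"
  \<comment> \<open>The choice \<open>(c, b)\<close> solves the symmetry condition
    \<open>d 1 * b = d 2 * c\<close>.\<close>
  define d :: "nat \<Rightarrow> real" where "d i = (if i = 1 then c else b)" for i
  have "0 < 2 * c * x ^ 2 - (c * b + b * c) * x * y + 2 * b * y ^ 2" if "x \<noteq> 0 \<or> y \<noteq> 0" for x y :: real
  proof -
    have bc: "0 < real (b * c) * (4 - real (b * c))"
      using assms le by (intro mult_pos_pos) (simp_all del: of_nat_mult)
    \<comment> \<open>Completing the square in \<open>2 * c\<close> times the form.\<close>
    have "0 < (2 * c * x - b * c * y) ^ 2 + real (b * c) * (4 - real (b * c)) * y ^ 2"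
    proof (cases "y = 0")
      case True
      then show ?thesis
        using that assms by simp
    next
      case False
      then show ?thesis
        by (intro add_nonneg_pos mult_pos_pos[OF bc]) simp_all
    qed
    also have "\<dots> = 2 * c * (2 * c * x ^ 2 - (c * b + b * c) * x * y + 2 * b * y ^ 2)"
      by (simp add: algebra_simps power2_eq_square)
    finally show ?thesis
      using assms by (simp add: zero_less_mult_iff)
  qed
  then show "finite_type 2 (cartan2 b c)"
    unfolding finite_type_cartan2_quadratic_form using assms
    by (intro exI[where x = d]) (simp add: d_def)
qed

lemma same_type_cartan2:
  "same_type 2 (cartan2 b c) (cartan2 d e) \<longleftrightarrow> (b, c) = (d, e) \<or> (b, c) = (e, d)"
proof -
  have I: "{1..2::nat} = {1, 2}"
    by auto
  show ?thesis
  proof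
    assume "same_type 2 (cartan2 b c) (cartan2 d e)"
    then obtain p :: "nat \<Rightarrow> nat" where p: "bij_betw p {1, 2} {1, 2}"
      "cartan2 b c (p 1) (p 2) = cartan2 d e 1 2" "cartan2 b c (p 2) (p 1) = cartan2 d e 2 1"
      unfolding same_type_def I by auto
    from p(1) have "p 1 = 1 \<and> p 2 = 2 \<or> p 1 = 2 \<and> p 2 = 1"
      unfolding bij_betw_def by (metis image_insert image_empty doubleton_eq_iff)
    with p(2,3) show "(b, c) = (d, e) \<or> (b, c) = (e, d)"
      by (auto simp: cartan2_def)
  next
    assume "(b, c) = (d, e) \<or> (b, c) = (e, d)"
    then show "same_type 2 (cartan2 b c) (cartan2 d e)"
    proof
      assume "(b, c) = (d, e)"
      then show ?thesis
        unfolding same_type_def by (intro exI[of _ id]) auto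
    next
      assume "(b, c) = (e, d)"
      moreover have "bij_betw (\<lambda>i. 3 - i) {1, 2::nat} {1, 2}"
        by (auto simp: bij_betw_def inj_on_def)
      ultimately show ?thesis
        unfolding same_type_def I by (intro exI[of _ "\<lambda>i. 3 - i"]) (auto simp: cartan2_def)
    qed
  qed
qed

theorem theorem4p8:
  fixes b c :: nat
  assumes "0 < b" and "0 < c"
  shows
    "(finite (Y_frieze_patterns 2 (cartan2 b c)) \<longleftrightarrow> finite_type 2 (cartan2 b c)) \<and>
     (finite_type 2 (cartan2 b c) \<longleftrightarrow> b * c \<le> 3) \<and>
     (type_A2 (cartan2 b c) \<longleftrightarrow> b * c = 1) \<and>
     (type_C2 (cartan2 b c) \<longleftrightarrow> b * c = 2) \<and>
     (type_G2 (cartan2 b c) \<longleftrightarrow> b * c = 3) \<and>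
     (type_A2 (cartan2 b c) \<longrightarrow> card (Y_frieze_patterns 2 (cartan2 b c)) = 5) \<and>
     (type_C2 (cartan2 b c) \<longrightarrow> card (Y_frieze_patterns 2 (cartan2 b c)) = 10) \<and>
     (type_G2 (cartan2 b c) \<longrightarrow> card (Y_frieze_patterns 2 (cartan2 b c)) = 21)"
proof -
  let ?Y = "Y_frieze_patterns 2 (cartan2 b c)"
  \<comment> \<open>Each \<open>d\<close> is 1 or a prime, so \<open>b * c = d\<close> leaves only
    \<open>(d, 1)\<close> and \<open>(1, d)\<close>.\<close>
  have type: "same_type 2 (cartan2 b c) (cartan2 d 1) \<longleftrightarrow> b * c = d" if "d \<in> {1, 2, 3}" for d
  proof
    assume bc: "b * c = d"
    then have "b \<le> d" "c \<le> d"
      using assms by auto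
    with that assms have "b \<in> {1, 2, 3}" "c \<in> {1, 2, 3}"
      by auto
    with that bc show "same_type 2 (cartan2 b c) (cartan2 d 1)"
      by (auto simp: same_type_cartan2)
  qed (auto simp: same_type_cartan2)
  have card_d: "card ?Y = card (first_rows d)" if "b * c = d" "d \<in> {1, 2, 3}" for d
  proof -
    have "(b, c) = (d, 1) \<or> (b, c) = (1, d)"
      using type[OF that(2)] that(1) by (simp add: same_type_cartan2)
    then show ?thesis
      using bij_betw_same_card[OF bij_betw_frieze_rows[of b c]]
      by (auto simp: card_frieze_rows_first_rows[unfolded One_nat_def] card_frieze_rows_swap[of "Suc 0" d])
  qed
  have cards: "b * c = 1 \<Longrightarrow> card ?Y = 5" "b * c = 2 \<Longrightarrow> card ?Y = 10" "b * c = 3 \<Longrightarrow> card ?Y = 21"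
    using card_d card_first_rows_A2 card_first_rows_C2 card_first_rows_G2 by auto
  have "finite ?Y \<longleftrightarrow> b * c \<le> 3"
  proof
    assume "finite ?Y"
    then have "finite (frieze_rows b c)"
      using bij_betw_finite[OF bij_betw_frieze_rows] by blast
    then show "b * c \<le> 3"
      using infinite_frieze_rows[OF assms] by linarith
  next
    assume "b * c \<le> 3"
    then have "b * c = 1 \<or> b * c = 2 \<or> b * c = 3"
      using assms by (metis One_nat_def Suc_leI le_antisym mult_pos_pos not_less_eq_eq numeral_2_eq_2 numeral_3_eq_3)
    \<comment> \<open>Infinite sets have \<open>card\<close> 0, so the positive counts already prove
      finiteness.\<close>
    then have "0 < card ?Y"
      using cards by auto
    then show "finite ?Y"
      by (rule card_ge_0_finite)
  qed
  then show ?thesis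
    using finite_type_cartan2[OF assms] type[of 1] type[of 2] type[of 3] cards by auto
qed

end
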